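(* Let $p>1$ and let $N\ge1$ be an integer. The mapping $S_p:C^0[0,1]\to C^1[0,1]$ defined by $$S_p(h)(r):=\int_r^1\phi_{p'}\left(\int_0^s\left(\frac{t}{s}\right)^{N-1}h(t)\,\mathrm{d}t\right)\mathrm{d}s,\qquad r\in[0,1],$$ is continuous, bounded and compact.
   Context: For $q>1$, $\phi_q(\xi):=|\xi|^{q-2}\xi$ for $\xi\in\mathbb{R}$ (with $\phi_q(0)=0$), and $p':=p/(p-1)$. $C^n[0,1]$ carries its usual sup-type norm $|\cdot|_n$. The inner integral is understood to be $0$ at $s=0$. "Bounded" means that bounded sets are mapped to bounded sets; $S_p$ is a nonlinear map. *)

theory Defs
  imports "HOL-Analysis.Analysis"
begin

definition phi :: "real \<Rightarrow> real \<Rightarrow> real" where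
  "phi q x = \<bar>x\<bar> powr (q - 2) * x"

definition conj_exp :: "real \<Rightarrow> real" where
  "conj_exp p = p / (p - 1)"

text \<open>The derivative is taken within [0,1], hence is one-sided at the end points. The values of
  the following operator outside [0,1] are irrelevant.\<close>

definition deriv01 :: "(real \<Rightarrow> real) \<Rightarrow> real \<Rightarrow> real" where
  "deriv01 u x = vector_derivative u (at x within {0..1})"

definition Cn_on01 :: "nat \<Rightarrow> (real \<Rightarrow> real) \<Rightarrow> bool" where
  "Cn_on01 n u \<longleftrightarrow>
     (\<forall>k<n. (deriv01 ^^ k) u differentiable_on {0..1}) \<and>
     continuous_on {0..1} ((deriv01 ^^ n) u)"

definition Cn_norm :: "nat \<Rightarrow> (real \<Rightarrow> real) \<Rightarrow> real" where
  "Cn_norm n u = (MAX k\<in>{..n}. SUP x\<in>{0..1}. \<bar>(deriv01 ^^ k) u x\<bar>)"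

text \<open>Functions on [0,1] are represented as members of \<^term>\<open>extensional {0..1}\<close>, so that
  two elements of the space are equal iff they agree on [0,1].\<close>

definition Cn_space :: "nat \<Rightarrow> (real \<Rightarrow> real) set" where
  "Cn_space n = {u \<in> extensional {0..1}. Cn_on01 n u}"

text \<open>The distance is set to 0 off the space only because \<^locale>\<open>Metric_space\<close> demands
  nonnegativity for all arguments.\<close>

definition Cn_dist :: "nat \<Rightarrow> (real \<Rightarrow> real) \<Rightarrow> (real \<Rightarrow> real) \<Rightarrow> real" where
  "Cn_dist n u v =
     (if u \<in> Cn_space n \<and> v \<in> Cn_space n then Cn_norm n (\<lambda>x. u x - v x) else 0)"

definition Cn_metric :: "nat \<Rightarrow> (real \<Rightarrow> real) metric" where
  "Cn_metric n = metric (Cn_space n, Cn_dist n)"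

lemma deriv01_cong:
  assumes "\<And>y. y \<in> {0..1} \<Longrightarrow> u y = v y" "x \<in> {0..1}"
  shows "deriv01 u x = deriv01 v x"
  unfolding deriv01_def
  by (rule vector_derivative_cong_eq) (use assms in \<open>auto intro: always_eventually\<close>)

lemma deriv01_diff:
  assumes "u differentiable_on {0..1}" "v differentiable_on {0..1}" "x \<in> {0..1}"
  shows "deriv01 (\<lambda>x. u x - v x) x = deriv01 u x - deriv01 v x"
proof -
  have "(u has_vector_derivative deriv01 u x) (at x within {0..1})"
       "(v has_vector_derivative deriv01 v x) (at x within {0..1})"
    using assms by (auto simp: deriv01_def differentiable_on_def vector_derivative_works[symmetric])
  then have "((\<lambda>x. u x - v x) has_vector_derivative (deriv01 u x - deriv01 v x))
      (at x within {0..1})"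
    by (rule has_vector_derivative_diff)
  then show ?thesis
    unfolding deriv01_def
    using vector_derivative_within_closed_interval[of 0 1 x] assms(3) by simp
qed

lemma deriv01_funpow_diff:
  assumes "\<forall>j<k. (deriv01 ^^ j) u differentiable_on {0..1}"
    and "\<forall>j<k. (deriv01 ^^ j) v differentiable_on {0..1}"
    and "x \<in> {0..1}"
  shows "(deriv01 ^^ k) (\<lambda>x. u x - v x) x = (deriv01 ^^ k) u x - (deriv01 ^^ k) v x"
  using assms
proof (induction k arbitrary: x)
  case 0
  then show ?case by simp
next
  case (Suc k)
  have "(deriv01 ^^ Suc k) (\<lambda>x. u x - v x) x
      = deriv01 (\<lambda>x. (deriv01 ^^ k) u x - (deriv01 ^^ k) v x) x"
    using Suc by (auto intro!: deriv01_cong)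
  also have "\<dots> = (deriv01 ^^ Suc k) u x - (deriv01 ^^ Suc k) v x"
    using Suc.prems by (simp add: deriv01_diff)
  finally show ?case .
qed

lemma Cn_on01_continuous:
  assumes "Cn_on01 n u" "k \<le> n"
  shows "continuous_on {0..1} ((deriv01 ^^ k) u)"
  using assms by (cases "k = n") (auto simp: Cn_on01_def differentiable_imp_continuous_on)

lemma Cn_dist_le_iff:
  assumes u: "u \<in> Cn_space n" and v: "v \<in> Cn_space n"
  shows "Cn_dist n u v \<le> B \<longleftrightarrow>
    (\<forall>k\<le>n. \<forall>x\<in>{0..1}. \<bar>(deriv01 ^^ k) u x - (deriv01 ^^ k) v x\<bar> \<le> B)"
proof -
  have diff: "(deriv01 ^^ k) (\<lambda>x. u x - v x) x = (deriv01 ^^ k) u x - (deriv01 ^^ k) v x"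
    if "k \<le> n" "x \<in> {0..1}" for k x
    by (rule deriv01_funpow_diff) (use u v that in \<open>auto simp: Cn_space_def Cn_on01_def\<close>)
  have "(SUP x\<in>{0..1}. \<bar>(deriv01 ^^ k) (\<lambda>x. u x - v x) x\<bar>) \<le> B \<longleftrightarrow>
      (\<forall>x\<in>{0..1}. \<bar>(deriv01 ^^ k) u x - (deriv01 ^^ k) v x\<bar> \<le> B)" if k: "k \<le> n" for k
  proof -
    have "continuous_on {0..1} (\<lambda>x. \<bar>(deriv01 ^^ k) u x - (deriv01 ^^ k) v x\<bar>)"
      using u v k by (intro continuous_intros Cn_on01_continuous) (auto simp: Cn_space_def)
    then have "bdd_above ((\<lambda>x. \<bar>(deriv01 ^^ k) u x - (deriv01 ^^ k) v x\<bar>) ` {0..1})"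
      by (intro bounded_imp_bdd_above compact_imp_bounded compact_continuous_image) auto
    then show ?thesis
      using k by (simp add: diff cSUP_le_iff cong: SUP_cong_simp)
  qed
  then show ?thesis
    using u v by (auto simp: Cn_dist_def Cn_norm_def)
qed

lemma Metric_space_Cn: "Metric_space (Cn_space n) (Cn_dist n)"
proof
  have nn: "0 \<le> Cn_dist n u v" if "u \<in> Cn_space n" "v \<in> Cn_space n" for u v
    using Cn_dist_le_iff[OF that, of "Cn_dist n u v"] abs_ge_zero order_trans
    by (metis atLeastAtMost_iff order_refl zero_le_one)
  then show "0 \<le> Cn_dist n u v" for u v
    by (cases "u \<in> Cn_space n \<and> v \<in> Cn_space n") (auto simp: Cn_dist_def)
  have "Cn_dist n u v \<le> Cn_dist n v u" if "u \<in> Cn_space n" "v \<in> Cn_space n" for u v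
    using that by (metis Cn_dist_le_iff abs_minus_commute order_refl)
  then show "Cn_dist n u v = Cn_dist n v u" for u v
    by (cases "u \<in> Cn_space n \<and> v \<in> Cn_space n") (auto simp: Cn_dist_def intro: antisym)
  show "Cn_dist n u v = 0 \<longleftrightarrow> u = v" if uv: "u \<in> Cn_space n" "v \<in> Cn_space n" for u v
  proof
    assume "Cn_dist n u v = 0"
    then have "u x = v x" if "x \<in> {0..1}" for x
      using Cn_dist_le_iff[OF uv, of 0] that by (auto dest: spec[of _ 0])
    then show "u = v"
      using uv by (auto simp: Cn_space_def intro: extensionalityI)
  next
    assume "u = v"
    then show "Cn_dist n u v = 0"
      using Cn_dist_le_iff[OF uv, of 0] nn[OF uv] by simp
  qed
  show "Cn_dist n u w \<le> Cn_dist n u v + Cn_dist n v w"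
    if u: "u \<in> Cn_space n" and v: "v \<in> Cn_space n" and w: "w \<in> Cn_space n" for u v w
    unfolding Cn_dist_le_iff[OF u w]
  proof (intro allI impI ballI)
    fix k x assume kx: "k \<le> n" "x \<in> {0..1::real}"
    have "\<bar>(deriv01 ^^ k) u x - (deriv01 ^^ k) v x\<bar> \<le> Cn_dist n u v"
         "\<bar>(deriv01 ^^ k) v x - (deriv01 ^^ k) w x\<bar> \<le> Cn_dist n v w"
      using Cn_dist_le_iff[OF u v] Cn_dist_le_iff[OF v w] kx by blast+
    then show "\<bar>(deriv01 ^^ k) u x - (deriv01 ^^ k) w x\<bar> \<le> Cn_dist n u v + Cn_dist n v w"
      by linarith
  qed
qed

lemma mspace_Cn_metric [simp]: "mspace (Cn_metric n) = Cn_space n"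
  by (simp add: Cn_metric_def Metric_space.mspace_metric Metric_space_Cn)

lemma mdist_Cn_metric [simp]: "mdist (Cn_metric n) = Cn_dist n"
  by (simp add: Cn_metric_def Metric_space.mdist_metric Metric_space_Cn)

text \<open>For \<open>n = 0\<close> this is the library's space of continuous functions on [0,1].\<close>

lemma mspace_Cn_metric_0:
  "mspace (Cn_metric 0) = mspace (cfunspace (top_of_set {0..1}) euclidean_metric)"
proof -
  have "Met_TC.mbounded (u ` {0..1})" if "continuous_on {0..1} u" for u :: "real \<Rightarrow> real"
    using compact_imp_bounded[OF compact_continuous_image[OF that compact_Icc]]
    by (auto simp: Met_TC.mbounded_alt bounded_two_points)
  then show ?thesis
    by (auto simp: Cn_space_def Cn_on01_def)
qed

lemma mdist_Cn_metric_0: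
  assumes "u \<in> mspace (Cn_metric 0)" "v \<in> mspace (Cn_metric 0)"
  shows "mdist (Cn_metric 0) u v = mdist (cfunspace (top_of_set {0..1}) euclidean_metric) u v"
proof -
  have "mdist (Cn_metric 0) u v \<le> B \<longleftrightarrow>
      mdist (cfunspace (top_of_set {0..1}) euclidean_metric) u v \<le> B" for B
    by (subst cfunspace_mdist_le)
      (use assms mspace_Cn_metric_0 in
        \<open>auto simp: Cn_dist_le_iff dist_real_def simp del: mspace_cfunspace\<close>)
  then show ?thesis
    by (meson antisym order_refl)
qed

abbreviation mbounded_of :: "'a metric \<Rightarrow> 'a set \<Rightarrow> bool" where
  "mbounded_of m \<equiv> Metric_space.mbounded (mspace m) (mdist m)"

definition bounded_map :: "'a metric \<Rightarrow> 'b metric \<Rightarrow> ('a \<Rightarrow> 'b) \<Rightarrow> bool" where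
  "bounded_map m1 m2 f \<longleftrightarrow> (\<forall>B. mbounded_of m1 B \<longrightarrow> mbounded_of m2 (f ` B))"

text \<open>Images of bounded sets are relatively compact. The inclusion of the image in the target
  space has to be required, since \<^const>\<open>closure_of\<close> ignores points off the space.\<close>

definition compact_map :: "'a metric \<Rightarrow> 'b metric \<Rightarrow> ('a \<Rightarrow> 'b) \<Rightarrow> bool" where
  "compact_map m1 m2 f \<longleftrightarrow>
     (\<forall>B. mbounded_of m1 B \<longrightarrow> f ` B \<subseteq> mspace m2 \<and>
        compactin (mtopology_of m2) (mtopology_of m2 closure_of (f ` B)))"

text \<open>At \<open>s = 0\<close> the inner integral is over \<open>{0..0}\<close> and thus 0.\<close>

definition S_op :: "real \<Rightarrow> nat \<Rightarrow> (real \<Rightarrow> real) \<Rightarrow> real \<Rightarrow> real" where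
  "S_op p N h = (\<lambda>r\<in>{0..1}.
     integral {r..1} (\<lambda>s. phi (conj_exp p) (integral {0..s} (\<lambda>t. (t / s) ^ (N - 1) * h t))))"

end

theory Submission
  imports Defs "HOL-Complex_Analysis.Great_Picard"
begin

text \<open>The operator factors as the weighted mean \<open>h \<mapsto> \<integral>\<^sub>0\<^sup>s (t/s)\<^sup>N\<^sup>-\<^sup>1 h(t) dt\<close> followed by
  \<open>g \<mapsto> \<integral>\<^sub>r\<^sup>1 \<phi>(g(s)) ds\<close>. The first map turns a sup bound on \<open>h\<close> into a Lipschitz bound, so it maps
  bounded subsets of \<open>C\<^sup>0\<close> into compact ones by Arzela-Ascoli; the second is continuous
  from \<open>C\<^sup>0\<close> to \<open>C\<^sup>1\<close> because \<open>\<phi>\<close> is uniformly continuous on compact intervals.\<close>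

section \<open>The two factors of the operator\<close>

definition weighted_mean :: "nat \<Rightarrow> (real \<Rightarrow> real) \<Rightarrow> real \<Rightarrow> real" where
  "weighted_mean k h = (\<lambda>s\<in>{0..1}. integral {0..s} (\<lambda>t. (t / s) ^ k * h t))"

definition phi_tail_integral :: "real \<Rightarrow> (real \<Rightarrow> real) \<Rightarrow> real \<Rightarrow> real" where
  "phi_tail_integral q g = (\<lambda>r\<in>{0..1}. integral {r..1} (\<lambda>s. phi q (g s)))"

text \<open>The restriction to [0,1] inside \<open>weighted_mean\<close> makes its values elements
  of C^0. The outer integral cannot see it, since it only evaluates at points of [r,1] with r in
  [0,1]. So the factorization is an identity of operators, valid for every argument.\<close>

lemma S_op_eq_comp: "S_op p N = phi_tail_integral (conj_exp p) \<circ> weighted_mean (N - 1)"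
  by (intro ext) (auto simp: S_op_def phi_tail_integral_def weighted_mean_def fun_eq_iff
      intro!: integral_cong)

section \<open>Continuity of the power function\<close>

lemma continuous_on_phi:
  assumes "q > 1"
  shows "continuous_on A (phi q)"
proof -
  \<comment> \<open>For q < 2 the exponent \<open>q - 2\<close> is negative, and continuity at 0 is
    hidden in the product. Splitting into positive and negative parts leaves the positive exponent
    \<open>q - 1\<close>, for which \<open>powr\<close> is continuous up to base 0.\<close>
  have "phi q x = max x 0 powr (q - 1) - max (- x) 0 powr (q - 1)" for x
    using powr_mult_base[of "\<bar>x\<bar>" "q - 2"]
    by (auto simp: phi_def max_def abs_if mult.commute)
  moreover have "continuous_on A (\<lambda>x::real. max x 0 powr (q - 1) - max (- x) 0 powr (q - 1))"
    by (intro continuous_intros continuous_on_powr') (use assms in auto)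
  ultimately show ?thesis
    by (simp cong: continuous_on_cong)
qed

text \<open>Only \<open>x\<close> is confined to [-M,M]: it will be a value of a fixed function, and
  \<open>y\<close> the value of a nearby function for which no bound is known beforehand. Uniform
  continuity is therefore taken on an interval larger by 1 on each side.\<close>

lemma phi_uniform_estimate:
  assumes "q > 1" "e > 0"
  obtains d where "d > 0" "\<And>x y. \<bar>x\<bar> \<le> M \<Longrightarrow> \<bar>x - y\<bar> < d \<Longrightarrow> \<bar>phi q x - phi q y\<bar> < e"
proof -
  have "uniformly_continuous_on {-M-1..M+1} (phi q)"
    by (intro compact_uniformly_continuous continuous_on_phi assms) auto
  then obtain d where "d > 0" and
    d: "\<And>x y. x \<in> {-M-1..M+1} \<Longrightarrow> y \<in> {-M-1..M+1} \<Longrightarrow> dist y x < d \<Longrightarrow>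
      dist (phi q y) (phi q x) < e"
    using \<open>e > 0\<close> unfolding uniformly_continuous_on_def by metis
  show ?thesis
  proof
    \<comment> \<open>The cap 1 keeps \<open>y\<close> inside the enlarged interval.\<close>
    show "min d 1 > 0" using \<open>d > 0\<close> by simp
    show "\<bar>phi q x - phi q y\<bar> < e" if "\<bar>x\<bar> \<le> M" "\<bar>x - y\<bar> < min d 1" for x y
    proof -
      have "x \<in> {-M-1..M+1}" "y \<in> {-M-1..M+1}" "dist x y < d"
        using that by (auto simp: dist_real_def)
      with d[of y x] show ?thesis by (simp add: dist_real_def)
    qed
  qed
qed

section \<open>Working forms of membership, distance and continuity for the spaces C^n[0,1]\<close>

lemma Cn_space_0_iff: "u \<in> Cn_space 0 \<longleftrightarrow> u \<in> extensional {0..1} \<and> continuous_on {0..1} u"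
  by (simp add: Cn_space_def Cn_on01_def)

lemma Cn_space_0_bounded:
  assumes "u \<in> Cn_space 0"
  obtains M where "\<And>t. t \<in> {0..1} \<Longrightarrow> \<bar>u t\<bar> \<le> M"
proof -
  have "bounded (u ` {0..1})"
    using assms by (intro compact_imp_bounded compact_continuous_image) (auto simp: Cn_space_0_iff)
  then have "\<exists>M. \<forall>t\<in>{0..1}. \<bar>u t\<bar> \<le> M"
    by (simp add: bounded_iff)
  then show ?thesis using that by blast
qed

lemma Cn_dist_0_le_iff:
  assumes "u \<in> Cn_space 0" "v \<in> Cn_space 0"
  shows "Cn_dist 0 u v \<le> B \<longleftrightarrow> (\<forall>x\<in>{0..1}. \<bar>u x - v x\<bar> \<le> B)"
  by (simp add: Cn_dist_le_iff[OF assms])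

lemma Cn_continuous_map_iff:
  "continuous_map (mtopology_of (Cn_metric m)) (mtopology_of (Cn_metric n)) f \<longleftrightarrow>
     f ` Cn_space m \<subseteq> Cn_space n \<and>
     (\<forall>u\<in>Cn_space m. \<forall>e>0. \<exists>d>0. \<forall>v. v \<in> Cn_space m \<and> Cn_dist m u v < d \<longrightarrow>
        Cn_dist n (f u) (f v) < e)"
  using Metric_space.metric_continuous_map[OF Metric_space_Cn Metric_space_Cn, of m n f]
  by (simp add: mtopology_of_def)

section \<open>The weighted mean as a map from C^0 to C^0\<close>

lemma continuous_on_weight:
  fixes s :: real
  assumes "continuous_on A h"
  shows "continuous_on A (\<lambda>t. (t / s) ^ k * h t)"
  \<comment> \<open>Multiplication by \<open>inverse s\<close> is continuous in t for every s; at s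
    = 0 the weight is the constant \<open>0 ^ k\<close>.\<close>
  using assms by (auto simp: divide_inverse intro!: continuous_intros)

text \<open>For a \<le> b the difference splits into the change of weight on [0,a] and the new piece
  on [a,b]. The weight lies in [0,1], so the new piece costs M(b - a). The change of weight is at
  most k(b - a)/b pointwise, hence costs at most kM(b - a) after integration. Only the sup bound of
  \<open>h\<close> enters, which is what makes images of bounded sets equicontinuous.\<close>

lemma weighted_mean_Lipschitz:
  assumes cont: "continuous_on {0..1} h" and bound: "\<And>t. t \<in> {0..1} \<Longrightarrow> \<bar>h t\<bar> \<le> M"
    and xy: "x \<in> {0..1}" "y \<in> {0..1}"
  shows "\<bar>weighted_mean k h x - weighted_mean k h y\<bar> \<le> real (Suc k) * M * \<bar>x - y\<bar>"
  using xy
proof (induction x y rule: linorder_wlog)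
  case (le a b)
  then have ab: "0 \<le> a" "a \<le> b" "b \<le> 1" by auto
  have M: "0 \<le> M"
    using bound[of 0] by auto
  have cont': "continuous_on {c..d} (\<lambda>t. (t / s) ^ k * h t)" if "0 \<le> c" "d \<le> 1" for c d s
    using that by (intro continuous_on_weight continuous_on_subset[OF cont]) auto
  let ?f = "\<lambda>s t. (t / s) ^ k * h t"
  have "integral {0..b} (?f b) = integral {0..a} (?f b) + integral {a..b} (?f b)"
    using ab by (intro Henstock_Kurzweil_Integration.integral_combine[symmetric]
        integrable_continuous_real cont') auto
  moreover have "integral {0..a} (\<lambda>t. ?f a t - ?f b t) = integral {0..a} (?f a) - integral {0..a} (?f b)"
    using ab by (intro integral_diff integrable_continuous_real cont') auto
  ultimately have split: "weighted_mean k h a - weighted_mean k h b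
      = integral {0..a} (\<lambda>t. ?f a t - ?f b t) - integral {a..b} (?f b)"
    using le by (simp add: weighted_mean_def)
  have "norm (integral {a..b} (?f b)) \<le> M * (b - a)"
  proof (rule integral_bound)
    fix t assume t: "t \<in> {a..b}"
    then have "0 \<le> t / b" "t / b \<le> 1"
      using ab by (auto simp: divide_le_eq)
    then have "\<bar>(t / b) ^ k\<bar> * \<bar>h t\<bar> \<le> 1 * M"
      using t ab by (intro mult_mono bound) (auto simp: power_le_one)
    then show "norm (?f b t) \<le> M"
      by (simp add: abs_mult)
  qed (use ab cont' in auto)
  moreover have "norm (integral {0..a} (\<lambda>t. ?f a t - ?f b t)) \<le> (k * ((b - a) / b) * M) * (a - 0)"
  proof (rule integral_bound)
    fix t assume t: "t \<in> {0..a}"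
    have r: "0 \<le> t / b" "t / b \<le> 1" "0 \<le> t / a" "t / a \<le> 1"
      using ab t by (auto simp: divide_le_eq)
    have "\<bar>t / a - t / b\<bar> \<le> (b - a) / b"
    \<comment> \<open>If a = 0 then t = 0 and both quotients vanish; otherwise t/a factors out of
      the difference.\<close>
    proof (cases "a = 0")
      case False
      then have "t / a - t / b = (t / a) * ((b - a) / b)"
        using ab by (simp add: field_simps)
      moreover have "\<bar>(t / a) * ((b - a) / b)\<bar> \<le> 1 * ((b - a) / b)"
        unfolding abs_mult using r ab by (intro mult_mono) auto
      ultimately show ?thesis by simp
    qed (use t ab in auto)
    \<comment> \<open>The k-th power is k-Lipschitz on the unit ball.\<close>
    then have "\<bar>(t / a) ^ k - (t / b) ^ k\<bar> \<le> k * ((b - a) / b)"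
      using norm_power_diff[of "t / a" "t / b" k] r
      by (smt (verit) mult_left_mono of_nat_0_le_iff real_norm_def)
    then have "\<bar>(t / a) ^ k - (t / b) ^ k\<bar> * \<bar>h t\<bar> \<le> (k * ((b - a) / b)) * M"
      using t ab by (intro mult_mono bound) auto
    then show "norm (?f a t - ?f b t) \<le> k * ((b - a) / b) * M"
      by (simp add: abs_mult flip: left_diff_distrib)
  qed (use ab cont' in \<open>auto intro!: continuous_on_diff\<close>)
  \<comment> \<open>The length a of the interval absorbs the factor 1/b, which would blow up near
    0.\<close>
  moreover have "(k * ((b - a) / b) * M) * (a - 0) = (k * M * (b - a)) * (a / b)"
    by simp
  moreover have "\<dots> \<le> (k * M * (b - a)) * 1"
    using ab M by (intro mult_left_mono) (auto simp: divide_le_eq)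
  ultimately have "\<bar>weighted_mean k h a - weighted_mean k h b\<bar> \<le> k * M * (b - a) + M * (b - a)"
    unfolding split real_norm_def by linarith
  then show ?case
    using ab by (simp add: algebra_simps)
next
  case (sym a b)
  then show ?case by (simp add: abs_minus_commute)
qed

lemma weighted_mean_0 [simp]: "weighted_mean k h 0 = 0"
  by (simp add: weighted_mean_def)

text \<open>The mean vanishes at 0, so this is the Lipschitz estimate with one point at 0. Keeping
  its constant lets one number serve as both sup bound and Lipschitz constant.\<close>

lemma weighted_mean_bound:
  assumes "continuous_on {0..1} h" "\<And>t. t \<in> {0..1} \<Longrightarrow> \<bar>h t\<bar> \<le> M" "x \<in> {0..1}"
  shows "\<bar>weighted_mean k h x\<bar> \<le> real (Suc k) * M"
proof -
  have "0 \<le> M" using assms(2)[of 0] by auto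
  have "\<bar>weighted_mean k h x\<bar> \<le> real (Suc k) * M * x"
    using weighted_mean_Lipschitz[OF assms(1,2,3), of 0 k] assms(3) by simp
  also have "\<dots> \<le> real (Suc k) * M * 1"
    using \<open>0 \<le> M\<close> assms(3) by (intro mult_left_mono) auto
  finally show ?thesis by simp
qed

lemma weighted_mean_in_Cn_space:
  assumes "h \<in> Cn_space 0"
  shows "weighted_mean k h \<in> Cn_space 0"
proof -
  have cont: "continuous_on {0..1} h"
    using assms by (simp add: Cn_space_0_iff)
  obtain M where M: "\<And>t. t \<in> {0..1} \<Longrightarrow> \<bar>h t\<bar> \<le> M"
    using Cn_space_0_bounded[OF assms] by blast
  have "0 \<le> M" using M[of 0] by auto
  have "(real (Suc k) * M)-lipschitz_on {0..1} (weighted_mean k h)"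
    using weighted_mean_Lipschitz[OF cont M] \<open>0 \<le> M\<close>
    by (intro lipschitz_onI) (auto simp: dist_real_def)
  then show ?thesis
    by (auto simp: Cn_space_0_iff weighted_mean_def intro: lipschitz_on_continuous_on)
qed

lemma weighted_mean_diff:
  assumes "continuous_on {0..1} h" "continuous_on {0..1} g" "x \<in> {0..1}"
  shows "weighted_mean k (\<lambda>t. h t - g t) x = weighted_mean k h x - weighted_mean k g x"
proof -
  have "continuous_on {0..x} h" "continuous_on {0..x} g"
    using assms by (auto elim: continuous_on_subset)
  then show ?thesis
    using assms(3)
    by (simp add: weighted_mean_def right_diff_distrib integral_diff
        integrable_continuous_real continuous_on_weight)
qed

text \<open>The mean is linear in \<open>h\<close>, so applying the sup bound to a difference, with
  the distance as M, gives a Lipschitz map with constant k + 1.\<close>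

lemma continuous_map_weighted_mean:
  "continuous_map (mtopology_of (Cn_metric 0)) (mtopology_of (Cn_metric 0)) (weighted_mean k)"
proof (rule Lipschitz_continuous_imp_continuous_map)
  show "Lipschitz_continuous_map (Cn_metric 0) (Cn_metric 0) (weighted_mean k)"
    unfolding Lipschitz_continuous_map_def
  proof (intro conjI exI ballI)
    fix h g assume "h \<in> mspace (Cn_metric 0)" "g \<in> mspace (Cn_metric 0)"
    then have hg: "h \<in> Cn_space 0" "g \<in> Cn_space 0" by auto
    then have c: "continuous_on {0..1} h" "continuous_on {0..1} g"
      by (auto simp: Cn_space_0_iff)
    have "\<bar>h t - g t\<bar> \<le> Cn_dist 0 h g" if "t \<in> {0..1}" for t
      using Cn_dist_0_le_iff[OF hg] that by blast
    then show "mdist (Cn_metric 0) (weighted_mean k h) (weighted_mean k g)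
        \<le> real (Suc k) * mdist (Cn_metric 0) h g"
      using weighted_mean_bound[of "\<lambda>t. h t - g t" "Cn_dist 0 h g" _ k] c
      by (simp add: Cn_dist_0_le_iff weighted_mean_in_Cn_space hg weighted_mean_diff
          continuous_on_diff)
  qed (auto intro: weighted_mean_in_Cn_space)
qed

section \<open>A compact set in C^0 containing the means of a bounded set\<close>

definition bounded_Lipschitz_family :: "real \<Rightarrow> (real \<Rightarrow> real) set" where
  "bounded_Lipschitz_family L = {u \<in> extensional {0..1}.
     (\<forall>x\<in>{0..1}. \<bar>u x\<bar> \<le> L) \<and> (\<forall>x\<in>{0..1}. \<forall>y\<in>{0..1}. \<bar>u x - u y\<bar> \<le> L * \<bar>x - y\<bar>)}"

lemma bounded_Lipschitz_family_subset: "bounded_Lipschitz_family L \<subseteq> Cn_space 0"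
proof
  fix u assume u: "u \<in> bounded_Lipschitz_family L"
  then have "0 \<le> L"
    unfolding bounded_Lipschitz_family_def by (auto dest!: bspec[of _ _ 0])
  then have "L-lipschitz_on {0..1} u"
    using u by (intro lipschitz_onI) (auto simp: bounded_Lipschitz_family_def dist_real_def)
  then show "u \<in> Cn_space 0"
    using u by (auto simp: Cn_space_0_iff bounded_Lipschitz_family_def
        intro: lipschitz_on_continuous_on)
qed

text \<open>Arzela-Ascoli yields a uniformly convergent subsequence. The defining inequalities are
  not strict and survive pointwise limits, so the limit stays in the family, which is compact itself
  and not just relatively compact.\<close>

lemma compactin_bounded_Lipschitz_family:
  "compactin (mtopology_of (Cn_metric 0)) (bounded_Lipschitz_family L)"
proof -
  let ?K = "bounded_Lipschitz_family L"
  interpret C0: Metric_space "Cn_space 0" "Cn_dist 0"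
    by (rule Metric_space_Cn)
  have "\<exists>l r. l \<in> ?K \<and> strict_mono r \<and> limitin C0.mtopology (\<sigma> \<circ> r) l sequentially"
    if \<sigma>: "range \<sigma> \<subseteq> ?K" for \<sigma> :: "nat \<Rightarrow> real \<Rightarrow> real"
  proof -
    have ext: "\<sigma> n \<in> extensional {0..1}"
      and bd: "\<And>x. x \<in> {0..1} \<Longrightarrow> \<bar>\<sigma> n x\<bar> \<le> L"
      and lip: "\<And>x y. x \<in> {0..1} \<Longrightarrow> y \<in> {0..1} \<Longrightarrow> \<bar>\<sigma> n x - \<sigma> n y\<bar> \<le> L * \<bar>x - y\<bar>" for n
      using subsetD[OF \<sigma> rangeI[of \<sigma> n]] by (auto simp: bounded_Lipschitz_family_def)
    have "0 \<le> L" using bd[of 0 0] by auto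
    obtain g r where g: "continuous_on {0..1} g" and r: "strict_mono (r :: nat \<Rightarrow> nat)"
      and conv: "\<And>e. 0 < e \<Longrightarrow> \<exists>N. \<forall>n x. n \<ge> N \<and> x \<in> {0..1} \<longrightarrow> norm (\<sigma> (r n) x - g x) < e"
    proof (rule Arzela_Ascoli[of "{0..1::real}" \<sigma> L])
      fix x e :: real assume x: "x \<in> {0..1}" and e: "0 < e"
      \<comment> \<open>The radius uses L + 1 because L may be 0.\<close>
      have "norm (\<sigma> n x - \<sigma> n y) < e" if "y \<in> {0..1}" "norm (x - y) < e / (L + 1)" for n y
      proof -
        have "\<bar>\<sigma> n x - \<sigma> n y\<bar> \<le> L * \<bar>x - y\<bar>"
          using lip x that by blast
        also have "\<dots> \<le> (L + 1) * \<bar>x - y\<bar>"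
          by (simp add: mult_right_mono)
        also have "\<dots> < e"
          using that(2) \<open>0 \<le> L\<close> by (simp add: field_simps)
        finally show ?thesis by simp
      qed
      then show "\<exists>d. 0 < d \<and> (\<forall>n y. y \<in> {0..1} \<and> norm (x - y) < d \<longrightarrow> norm (\<sigma> n x - \<sigma> n y) < e)"
        using e \<open>0 \<le> L\<close> by (intro exI[of _ "e / (L + 1)"]) auto
    qed (use bd in auto)
    have lim: "(\<lambda>n. \<sigma> (r n) x) \<longlonglongrightarrow> g x" if "x \<in> {0..1}" for x
      using conv that by (fastforce simp: LIMSEQ_iff)
    \<comment> \<open>The limit \<open>g\<close> is controlled only on [0,1]; its restriction is the
      representative in the space.\<close>
    let ?l = "restrict g {0..1}"
    have "?l \<in> ?K"
      unfolding bounded_Lipschitz_family_def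
    proof (intro CollectI conjI ballI)
      fix x y :: real assume xy: "x \<in> {0..1}" "y \<in> {0..1}"
      have "\<bar>g x\<bar> \<le> L"
        by (rule LIMSEQ_le_const2[OF tendsto_rabs[OF lim]]) (use xy bd in auto)
      then show "\<bar>?l x\<bar> \<le> L" using xy by simp
      have "\<bar>g x - g y\<bar> \<le> L * \<bar>x - y\<bar>"
        by (rule LIMSEQ_le_const2[OF tendsto_rabs[OF tendsto_diff[OF lim lim]]])
          (use xy lip in auto)
      then show "\<bar>?l x - ?l y\<bar> \<le> L * \<bar>x - y\<bar>" using xy by simp
    qed auto
    moreover have "limitin C0.mtopology (\<sigma> \<circ> r) ?l sequentially"
      unfolding C0.limit_metric_sequentially
    proof (intro conjI allI impI)
      show "?l \<in> Cn_space 0"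
        using bounded_Lipschitz_family_subset \<open>?l \<in> ?K\<close> by blast
      fix e :: real assume "0 < e"
      \<comment> \<open>Pointwise strict bounds give only a non-strict bound on the sup distance,
        hence \<open>e / 2\<close>.\<close>
      then obtain N where N: "\<And>n x. n \<ge> N \<Longrightarrow> x \<in> {0..1} \<Longrightarrow> \<bar>\<sigma> (r n) x - g x\<bar> < e / 2"
        using conv[of "e / 2"] by auto
      have "Cn_dist 0 (\<sigma> (r n)) ?l < e" if "n \<ge> N" for n
      proof -
        have "\<sigma> (r n) \<in> Cn_space 0"
          using \<sigma> bounded_Lipschitz_family_subset by blast
        then have "Cn_dist 0 (\<sigma> (r n)) ?l \<le> e / 2"
          using N[OF that] \<open>?l \<in> Cn_space 0\<close>
          by (subst Cn_dist_0_le_iff) (auto intro: less_imp_le)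
        then show ?thesis using \<open>0 < e\<close> by linarith
      qed
      then show "\<exists>N. \<forall>n\<ge>N. (\<sigma> \<circ> r) n \<in> Cn_space 0 \<and> Cn_dist 0 ((\<sigma> \<circ> r) n) ?l < e"
        using \<sigma> bounded_Lipschitz_family_subset by (intro exI[of _ N]) auto
    qed
    ultimately show ?thesis using r by blast
  qed
  then show ?thesis
    using bounded_Lipschitz_family_subset
    by (simp add: mtopology_of_def C0.compactin_sequentially)
qed

text \<open>Adjoining the zero function keeps the set bounded, and distances to zero are sup
  norms.\<close>

lemma mbounded_Cn_0_bound:
  assumes "mbounded_of (Cn_metric 0) B"
  obtains M where "\<And>h x. h \<in> B \<Longrightarrow> x \<in> {0..1} \<Longrightarrow> \<bar>h x\<bar> \<le> M"
proof -
  interpret C0: Metric_space "Cn_space 0" "Cn_dist 0"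
    by (rule Metric_space_Cn)
  let ?z = "\<lambda>x\<in>{0..1}. 0::real"
  have z: "?z \<in> Cn_space 0"
    by (auto simp: Cn_space_0_iff intro: continuous_on_eq[of _ "\<lambda>_. 0"])
  then have "C0.mbounded (insert ?z B)"
    using assms by (simp add: C0.mbounded_insert)
  then obtain M where sub: "B \<subseteq> Cn_space 0" and M: "\<And>h. h \<in> B \<Longrightarrow> Cn_dist 0 h ?z \<le> M"
    unfolding C0.mbounded_alt by blast
  show ?thesis
  proof
    fix h x assume "h \<in> B" and x: "x \<in> {0..1::real}"
    then have "\<forall>x\<in>{0..1}. \<bar>h x - ?z x\<bar> \<le> M"
      using M[of h] z sub by (auto simp: Cn_dist_0_le_iff)
    then show "\<bar>h x\<bar> \<le> M" using x by auto
  qed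
qed

lemma weighted_mean_image_subset:
  assumes "mbounded_of (Cn_metric 0) B"
  obtains L where "weighted_mean k ` B \<subseteq> bounded_Lipschitz_family L"
proof -
  obtain M where M: "\<And>h x. h \<in> B \<Longrightarrow> x \<in> {0..1} \<Longrightarrow> \<bar>h x\<bar> \<le> M"
    using mbounded_Cn_0_bound[OF assms] by metis
  have "B \<subseteq> Cn_space 0"
    using assms Metric_space.mbounded_subset_mspace[OF Metric_space_Cn] by auto
  then have "continuous_on {0..1} h" if "h \<in> B" for h
    using that by (auto simp: Cn_space_0_iff)
  then have "weighted_mean k ` B \<subseteq> bounded_Lipschitz_family (real (Suc k) * M)"
    using M weighted_mean_Lipschitz[of _ M] weighted_mean_bound[of _ M]
    by (auto simp: bounded_Lipschitz_family_def) (auto simp: weighted_mean_def)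
  then show ?thesis by (rule that)
qed

section \<open>The tail integral as a continuous map from C^0 to C^1\<close>

lemma phi_tail_integral_has_deriv:
  assumes "q > 1" "g \<in> Cn_space 0" "x \<in> {0..1}"
  shows "(phi_tail_integral q g has_vector_derivative - phi q (g x)) (at x within {0..1})"
proof -
  have "continuous_on {0..1} (\<lambda>s. phi q (g s))"
    using assms continuous_on_compose2[OF continuous_on_phi[of q UNIV]]
    by (auto simp: Cn_space_0_iff)
  from integral_has_vector_derivative'[OF this assms(3)] show ?thesis
    by (rule has_vector_derivative_transform[OF assms(3), rotated])
      (simp add: phi_tail_integral_def)
qed

lemma deriv01_phi_tail_integral:
  assumes "q > 1" "g \<in> Cn_space 0" "x \<in> {0..1}"
  shows "deriv01 (phi_tail_integral q g) x = - phi q (g x)"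
  unfolding deriv01_def
  using vector_derivative_within_closed_interval[OF _ _ phi_tail_integral_has_deriv[OF assms]]
    assms(3) by simp

lemma phi_tail_integral_in_Cn_space:
  assumes "q > 1" "g \<in> Cn_space 0"
  shows "phi_tail_integral q g \<in> Cn_space 1"
proof -
  have "continuous_on {0..1} (\<lambda>s. - phi q (g s))"
    using assms continuous_on_compose2[OF continuous_on_phi[of q UNIV]]
    by (auto simp: Cn_space_0_iff intro!: continuous_on_minus)
  then have "continuous_on {0..1} (deriv01 (phi_tail_integral q g))"
    by (rule continuous_on_eq) (simp add: deriv01_phi_tail_integral[OF assms])
  moreover have "phi_tail_integral q g differentiable_on {0..1}"
    using phi_tail_integral_has_deriv[OF assms]
    unfolding differentiable_on_def by (blast intro: differentiableI_vector)
  ultimately show ?thesis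
    by (auto simp: Cn_space_def Cn_on01_def) (auto simp: phi_tail_integral_def)
qed

text \<open>The derivatives differ by exactly the difference of the integrands, up to sign, and the
  functions by its integral over an interval of length at most 1. The C^1 norm is a maximum over
  both orders, so the same \<open>e\<close> suffices.\<close>

lemma Cn_dist_phi_tail_integral_le:
  assumes q: "q > 1" and g: "g \<in> Cn_space 0" and h: "h \<in> Cn_space 0"
    and le: "\<And>x. x \<in> {0..1} \<Longrightarrow> \<bar>phi q (g x) - phi q (h x)\<bar> \<le> e"
  shows "Cn_dist 1 (phi_tail_integral q g) (phi_tail_integral q h) \<le> e"
proof -
  have c: "continuous_on {x..1} (\<lambda>s. phi q (f s))" if "f \<in> Cn_space 0" "x \<in> {0..1}" for f x
    using q that continuous_on_compose2[OF continuous_on_phi[of q UNIV]]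
    by (force simp: Cn_space_0_iff elim: continuous_on_subset)
  have "0 \<le> e" using le[of 0] by auto
  have "\<bar>phi_tail_integral q g x - phi_tail_integral q h x\<bar> \<le> e" if x: "x \<in> {0..1}" for x
  proof -
    have "phi_tail_integral q g x - phi_tail_integral q h x
        = integral {x..1} (\<lambda>s. phi q (g s) - phi q (h s))"
      using x c g h by (simp add: phi_tail_integral_def integral_diff integrable_continuous_real)
    moreover have "norm (integral {x..1} (\<lambda>s. phi q (g s) - phi q (h s))) \<le> e * (1 - x)"
      by (rule integral_bound) (use x c g h le in \<open>auto intro!: continuous_on_diff\<close>)
    moreover have "e * (1 - x) \<le> e * 1"
      using x \<open>0 \<le> e\<close> by (intro mult_left_mono) auto
    ultimately show ?thesis by simp
  qed
  moreover have "\<bar>deriv01 (phi_tail_integral q g) x - deriv01 (phi_tail_integral q h) x\<bar> \<le> e"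
    if "x \<in> {0..1}" for x
    using le[OF that] deriv01_phi_tail_integral[OF q _ that] g h by simp
  ultimately have "\<forall>k\<le>1. \<forall>x\<in>{0..1}. \<bar>(deriv01 ^^ k) (phi_tail_integral q g) x
      - (deriv01 ^^ k) (phi_tail_integral q h) x\<bar> \<le> e"
    by (auto simp: le_Suc_eq)
  then show ?thesis
    using Cn_dist_le_iff[OF phi_tail_integral_in_Cn_space phi_tail_integral_in_Cn_space] q g h
    by blast
qed

lemma continuous_map_phi_tail_integral:
  assumes "q > 1"
  shows "continuous_map (mtopology_of (Cn_metric 0)) (mtopology_of (Cn_metric 1))
    (phi_tail_integral q)"
  unfolding Cn_continuous_map_iff
proof (intro conjI ballI allI impI)
  fix g :: "real \<Rightarrow> real" and e :: real
  assume g: "g \<in> Cn_space 0" and "0 < e"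
  obtain M where M: "\<And>t. t \<in> {0..1} \<Longrightarrow> \<bar>g t\<bar> \<le> M"
    using Cn_space_0_bounded[OF g] by blast
  \<comment> \<open>\<open>M\<close> bounds only the centre \<open>g\<close>; \<open>e / 2\<close>
    makes the final estimate strict.\<close>
  obtain d where "d > 0" and
    d: "\<And>x y. \<bar>x\<bar> \<le> M \<Longrightarrow> \<bar>x - y\<bar> < d \<Longrightarrow> \<bar>phi q x - phi q y\<bar> < e / 2"
    using phi_uniform_estimate[OF assms, of "e / 2" M] \<open>0 < e\<close> by auto
  have "Cn_dist 1 (phi_tail_integral q g) (phi_tail_integral q h) < e"
    if h: "h \<in> Cn_space 0" and "Cn_dist 0 g h < d" for h
  proof -
    have "\<bar>g x - h x\<bar> < d" if "x \<in> {0..1}" for x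
      using Cn_dist_0_le_iff[OF g h, of "Cn_dist 0 g h"] that \<open>Cn_dist 0 g h < d\<close> by fastforce
    then have "Cn_dist 1 (phi_tail_integral q g) (phi_tail_integral q h) \<le> e / 2"
      using d M by (intro Cn_dist_phi_tail_integral_le assms g h) (auto intro: less_imp_le)
    then show ?thesis using \<open>0 < e\<close> by simp
  qed
  then show "\<exists>d>0. \<forall>h. h \<in> Cn_space 0 \<and> Cn_dist 0 g h < d \<longrightarrow>
      Cn_dist 1 (phi_tail_integral q g) (phi_tail_integral q h) < e"
    using \<open>d > 0\<close> by blast
qed (use phi_tail_integral_in_Cn_space[OF assms] in blast)

section \<open>Compact maps between metric spaces\<close>

lemma compact_map_imp_bounded_map:
  assumes "compact_map m1 m2 f"
  shows "bounded_map m1 m2 f"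
  unfolding bounded_map_def
proof (intro allI impI)
  fix B assume "mbounded_of m1 B"
  then have sub: "f ` B \<subseteq> mspace m2"
    and comp: "compactin (mtopology_of m2) (mtopology_of m2 closure_of (f ` B))"
    using assms by (auto simp: compact_map_def)
  interpret M2: Metric_space "mspace m2" "mdist m2"
    by simp
  \<comment> \<open>Compact sets are bounded, and the image lies in its closure because
    \<open>sub\<close> places it in the space.\<close>
  have "M2.mbounded (mtopology_of m2 closure_of (f ` B))"
    using comp by (simp add: mtopology_of_def M2.compactin_imp_mbounded)
  then show "M2.mbounded (f ` B)"
    by (rule M2.mbounded_subset) (use sub in \<open>simp add: closure_of_subset\<close>)
qed

text \<open>Any compact superset of the image will do: it is closed in a Hausdorff space, so it
  contains the closure, which is then a closed subset of a compact set.\<close>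

lemma compact_mapI:
  assumes "\<And>B. mbounded_of m1 B \<Longrightarrow> \<exists>K. compactin (mtopology_of m2) K \<and> f ` B \<subseteq> K"
  shows "compact_map m1 m2 f"
  unfolding compact_map_def
proof (intro allI impI)
  fix B assume "mbounded_of m1 B"
  then obtain K where K: "compactin (mtopology_of m2) K" and sub: "f ` B \<subseteq> K"
    using assms by blast
  have "Hausdorff_space (mtopology_of m2)"
    by (simp add: mtopology_of_def Metric_space.Hausdorff_space_mtopology)
  then have "mtopology_of m2 closure_of (f ` B) \<subseteq> K"
    using K sub by (intro closure_of_minimal compactin_imp_closedin)
  then show "f ` B \<subseteq> mspace m2 \<and> compactin (mtopology_of m2) (mtopology_of m2 closure_of (f ` B))"
    using K sub compactin_subset_topspace[OF K] by (auto intro: closed_compactin)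
qed

theorem theorem5:
  fixes p :: real and N :: nat
  assumes "p > 1" and "N \<ge> 1"
  shows "S_op p N \<in> mspace (Cn_metric 0) \<rightarrow> mspace (Cn_metric 1) \<and>
    continuous_map (mtopology_of (Cn_metric 0)) (mtopology_of (Cn_metric 1)) (S_op p N) \<and>
    bounded_map (Cn_metric 0) (Cn_metric 1) (S_op p N) \<and>
    compact_map (Cn_metric 0) (Cn_metric 1) (S_op p N)"
proof -
  let ?T = "phi_tail_integral (conj_exp p)"
  have q: "conj_exp p > 1"
    using assms by (simp add: conj_exp_def)
  note T = continuous_map_phi_tail_integral[OF q]
  have cont: "continuous_map (mtopology_of (Cn_metric 0)) (mtopology_of (Cn_metric 1)) (S_op p N)"
    unfolding S_op_eq_comp using continuous_map_weighted_mean T by (rule continuous_map_compose)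
  have comp: "compact_map (Cn_metric 0) (Cn_metric 1) (S_op p N)"
  proof (rule compact_mapI)
    fix B assume "mbounded_of (Cn_metric 0) B"
    then obtain L where "weighted_mean (N - 1) ` B \<subseteq> bounded_Lipschitz_family L"
      by (rule weighted_mean_image_subset)
    then have "S_op p N ` B \<subseteq> ?T ` bounded_Lipschitz_family L"
      by (auto simp: S_op_eq_comp)
    \<comment> \<open>Compactness is gained in C^0 by the first factor and carried into C^1 by
      continuity of the second, so no equicontinuity of derivatives has to be checked.\<close>
    moreover have "compactin (mtopology_of (Cn_metric 1)) (?T ` bounded_Lipschitz_family L)"
      using compactin_bounded_Lipschitz_family T by (rule image_compactin)
    ultimately show "\<exists>K. compactin (mtopology_of (Cn_metric 1)) K \<and> S_op p N ` B \<subseteq> K"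
      by blast
  qed
  have "S_op p N \<in> mspace (Cn_metric 0) \<rightarrow> mspace (Cn_metric 1)"
    using continuous_map_funspace[OF cont] by simp
  \<comment> \<open>Boundedness is read off from compactness.\<close>
  with cont comp compact_map_imp_bounded_map[OF comp] show ?thesis
    by blast
qed

end
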